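(* Let $(\mathcal{A},\mathcal{B},l_{\mathcal{A}},r_{\mathcal{A}},l_{\mathcal{B}},r_{\mathcal{B}})$ be a matched pair of center-symmetric algebras. Then $(\mathcal{G}(\mathcal{A}),\mathcal{G}(\mathcal{B}),l_{\mathcal{A}}-r_{\mathcal{A}},l_{\mathcal{B}}-r_{\mathcal{B}})$ is a matched pair of the sub-adjacent Lie algebras $\mathcal{G}(\mathcal{A})$ and $\mathcal{G}(\mathcal{B})$.
   Context: Throughout, algebras are finite-dimensional over a field $\mathbb{K}$ of characteristic zero. A vector space with a bilinear product is a center-symmetric algebra if its associator $(x,y,z):=(xy)z-x(yz)$ satisfies $(x,y,z)=(z,y,x)$ for all $x,y,z$. The sub-adjacent Lie algebra $\mathcal{G}(\mathcal{A})$ of a center-symmetric algebra is the vector space $\mathcal{A}$ with bracket $[x,y]=xy-yx$. Bimodule: for linear maps $l,r:\mathcal{A}\to\mathfrak{gl}(V)$, $(l,r,V)$ is a bimodule of $\mathcal{A}$ if for all $x,y\in\mathcal{A}$: $[l_x,r_y]=[l_y,r_x]$ and $l_{xy}-l_xl_y=r_xr_y-r_{yx}$. Matched pair of center-symmetric algebras: given center-symmetric algebras $(\mathcal{A},\cdot)$, $(\mathcal{B},\circ)$, a bimodule $(l_{\mathcal{A}},r_{\mathcal{A}},\mathcal{B})$ of $\mathcal{A}$ and a bimodule $(l_{\mathcal{B}},r_{\mathcal{B}},\mathcal{A})$ of $\mathcal{B}$, the tuple $(\mathcal{A},\mathcal{B},l_{\mathcal{A}},r_{\mathcal{A}},l_{\mathcal{B}},r_{\mathcal{B}})$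 is a matched pair of center-symmetric algebras if for all $x,y\in\mathcal{A}$, $a,b\in\mathcal{B}$: $$-r_{\mathcal{A}}(x)(a\circ b)+r_{\mathcal{A}}(l_{\mathcal{B}}(b)x)a+a\circ(r_{\mathcal{A}}(x)b)+l_{\mathcal{A}}(r_{\mathcal{B}}(b)x)a+(l_{\mathcal{A}}(x)b)\circ a-l_{\mathcal{A}}(x)(b\circ a)=0,$$ $$-r_{\mathcal{B}}(a)(x\cdot y)+r_{\mathcal{B}}(l_{\mathcal{A}}(y)a)x+x\cdot(r_{\mathcal{B}}(a)y)+l_{\mathcal{B}}(r_{\mathcal{A}}(y)a)x+(l_{\mathcal{B}}(a)y)\cdot x-l_{\mathcal{B}}(a)(y\cdot x)=0,$$ $$a\circ(l_{\mathcal{A}}(x)b)+(r_{\mathcal{A}}(x)b)\circ a-(r_{\mathcal{A}}(x)a)\circ b-l_{\mathcal{A}}(l_{\mathcal{B}}(a)x)b+r_{\mathcal{A}}(r_{\mathcal{B}}(b)x)a+l_{\mathcal{A}}(l_{\mathcal{B}}(b)x)a-b\circ(l_{\mathcal{A}}(x)a)-r_{\mathcal{A}}(r_{\mathcal{B}}(a)x)b=0,$$ $$x\cdot(l_{\mathcal{B}}(a)y)+(r_{\mathcal{B}}(a)y)\cdot x-(r_{\mathcal{B}}(a)x)\cdot y-l_{\mathcal{B}}(l_{\mathcal{A}}(x)a)y+r_{\mathcal{B}}(r_{\mathcal{A}}(y)a)x+l_{\mathcal{B}}(l_{\mathcal{A}}(y)a)x-y\cdot(l_{\mathcal{B}}(a)x)-r_{\mathcal{B}}(r_{\mathcal{A}}(x)a)y=0.$$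 Matched pair of Lie algebras: for Lie algebras $\mathcal{G},\mathcal{H}$ and Lie algebra representations $\rho:\mathcal{G}\to\mathfrak{gl}(\mathcal{H})$, $\mu:\mathcal{H}\to\mathfrak{gl}(\mathcal{G})$, $(\mathcal{G},\mathcal{H},\rho,\mu)$ is a matched pair of Lie algebras if for all $x,y\in\mathcal{G}$, $a,b\in\mathcal{H}$: $$\rho(x)[a,b]-[\rho(x)a,b]-[a,\rho(x)b]+\rho(\mu(a)x)b-\rho(\mu(b)x)a=0,$$ $$\mu(a)[x,y]-[\mu(a)x,y]-[x,\mu(a)y]+\mu(\rho(x)a)y-\mu(\rho(y)a)x=0.$$ *)

theory Defs
  imports Complex_Main
begin

text \<open>
  A vector space over a field is a type of class \<open>ab_group_add\<close> together with a scalar multiplication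
  \<open>s\<close> such that \<open>vector_space s\<close>. The library locale for finite dimension carries a chosen basis as a
  parameter; here only the existence of a basis matters.
\<close>

definition finite_dimensional :: "('k::field \<Rightarrow> 'v::ab_group_add \<Rightarrow> 'v) \<Rightarrow> bool" where
  "finite_dimensional s \<longleftrightarrow> (\<exists>B. finite_dimensional_vector_space s B)"

definition bilinear_map ::
    "('k::field \<Rightarrow> 'u::ab_group_add \<Rightarrow> 'u) \<Rightarrow> ('k \<Rightarrow> 'v::ab_group_add \<Rightarrow> 'v) \<Rightarrow>
     ('k \<Rightarrow> 'w::ab_group_add \<Rightarrow> 'w) \<Rightarrow> ('u \<Rightarrow> 'v \<Rightarrow> 'w) \<Rightarrow> bool" where
  "bilinear_map sU sV sW f \<longleftrightarrow>
     (\<forall>u. Vector_Spaces.linear sV sW (f u)) \<and> (\<forall>v. Vector_Spaces.linear sU sW (\<lambda>u. f u v))"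

text \<open>
  A linear map from \<open>U\<close> to \<open>gl(V)\<close> (all linear endomorphisms of \<open>V\<close>) is encoded in curried form:
  the values are linear and the dependence on \<open>U\<close> is linear.
\<close>

abbreviation linear_to_gl ::
    "('k::field \<Rightarrow> 'u::ab_group_add \<Rightarrow> 'u) \<Rightarrow> ('k \<Rightarrow> 'v::ab_group_add \<Rightarrow> 'v) \<Rightarrow>
     ('u \<Rightarrow> 'v \<Rightarrow> 'v) \<Rightarrow> bool" where
  "linear_to_gl sU sV f \<equiv> bilinear_map sU sV sV f"

definition gl_bracket :: "('v::ab_group_add \<Rightarrow> 'v) \<Rightarrow> ('v \<Rightarrow> 'v) \<Rightarrow> 'v \<Rightarrow> 'v" where
  "gl_bracket f g = (\<lambda>v. f (g v) - g (f v))"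

definition associator :: "('a::ab_group_add \<Rightarrow> 'a \<Rightarrow> 'a) \<Rightarrow> 'a \<Rightarrow> 'a \<Rightarrow> 'a \<Rightarrow> 'a" where
  "associator m x y z = m (m x y) z - m x (m y z)"

locale center_symmetric_algebra =
  fixes s :: "'k::field \<Rightarrow> 'a::ab_group_add \<Rightarrow> 'a"
    and m :: "'a \<Rightarrow> 'a \<Rightarrow> 'a"
  assumes finite_dim: "finite_dimensional s"
    and bilinear: "bilinear_map s s s m"
    and center_symmetric: "\<And>x y z. associator m x y z = associator m z y x"

locale lie_algebra =
  fixes s :: "'k::field \<Rightarrow> 'a::ab_group_add \<Rightarrow> 'a"
    and br :: "'a \<Rightarrow> 'a \<Rightarrow> 'a"
  assumes finite_dim: "finite_dimensional s"
    and bilinear: "bilinear_map s s s br"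
    and alternating: "\<And>x. br x x = 0"
    and jacobi: "\<And>x y z. br x (br y z) + br y (br z x) + br z (br x y) = 0"

text \<open>The bracket of the sub-adjacent Lie algebra; its vector space is the given one.\<close>

definition sub_adjacent :: "('a::ab_group_add \<Rightarrow> 'a \<Rightarrow> 'a) \<Rightarrow> 'a \<Rightarrow> 'a \<Rightarrow> 'a" where
  "sub_adjacent m x y = m x y - m y x"

locale center_symmetric_bimodule = center_symmetric_algebra s m
  for s :: "'k::field \<Rightarrow> 'a::ab_group_add \<Rightarrow> 'a"
    and m :: "'a \<Rightarrow> 'a \<Rightarrow> 'a" +
  fixes sV :: "'k \<Rightarrow> 'v::ab_group_add \<Rightarrow> 'v"
    and l r :: "'a \<Rightarrow> 'v \<Rightarrow> 'v"
  assumes l_linear: "linear_to_gl s sV l"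
    and r_linear: "linear_to_gl s sV r"
    and commutator_symmetric: "\<And>x y. gl_bracket (l x) (r y) = gl_bracket (l y) (r x)"
    and l_r_mult: "\<And>x y v. l (m x y) v - l x (l y v) = r x (r y v) - r (m y x) v"

locale lie_representation = lie_algebra s br
  for s :: "'k::field \<Rightarrow> 'a::ab_group_add \<Rightarrow> 'a"
    and br :: "'a \<Rightarrow> 'a \<Rightarrow> 'a" +
  fixes sV :: "'k \<Rightarrow> 'v::ab_group_add \<Rightarrow> 'v"
    and \<rho> :: "'a \<Rightarrow> 'v \<Rightarrow> 'v"
  assumes rep_linear: "linear_to_gl s sV \<rho>"
    and rep_bracket: "\<And>x y. \<rho> (br x y) = gl_bracket (\<rho> x) (\<rho> y)"

locale center_symmetric_matched_pair =
  A: center_symmetric_algebra sA mA +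
  B: center_symmetric_algebra sB mB +
  AB: center_symmetric_bimodule sA mA sB lA rA +
  BA: center_symmetric_bimodule sB mB sA lB rB
  for sA :: "'k::field \<Rightarrow> 'a::ab_group_add \<Rightarrow> 'a"
    and mA :: "'a \<Rightarrow> 'a \<Rightarrow> 'a"  (infixl \<open>\<cdot>\<close> 70)
    and sB :: "'k \<Rightarrow> 'b::ab_group_add \<Rightarrow> 'b"
    and mB :: "'b \<Rightarrow> 'b \<Rightarrow> 'b"  (infixl \<open>\<odot>\<close> 70)
    and lA rA :: "'a \<Rightarrow> 'b \<Rightarrow> 'b"
    and lB rB :: "'b \<Rightarrow> 'a \<Rightarrow> 'a" +
  assumes matched1: "\<And>x a b.
      - rA x (a \<odot> b) + rA (lB b x) a + a \<odot> rA x b + lA (rB b x) a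
      + lA x b \<odot> a - lA x (b \<odot> a) = 0"
    and matched2: "\<And>a x y.
      - rB a (x \<cdot> y) + rB (lA y a) x + x \<cdot> rB a y + lB (rA y a) x
      + lB a y \<cdot> x - lB a (y \<cdot> x) = 0"
    and matched3: "\<And>x a b.
      a \<odot> lA x b + rA x b \<odot> a - rA x a \<odot> b - lA (lB a x) b + rA (rB b x) a
      + lA (lB b x) a - b \<odot> lA x a - rA (rB a x) b = 0"
    and matched4: "\<And>a x y.
      x \<cdot> lB a y + rB a y \<cdot> x - rB a x \<cdot> y - lB (lA x a) y + rB (rA y a) x
      + lB (lA y a) x - y \<cdot> lB a x - rB (rA x a) y = 0"

locale lie_matched_pair =
  G: lie_algebra sG brG +
  H: lie_algebra sH brH +
  GH: lie_representation sG brG sH \<rho> +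
  HG: lie_representation sH brH sG \<mu>
  for sG :: "'k::field \<Rightarrow> 'g::ab_group_add \<Rightarrow> 'g"
    and brG :: "'g \<Rightarrow> 'g \<Rightarrow> 'g"
    and sH :: "'k \<Rightarrow> 'h::ab_group_add \<Rightarrow> 'h"
    and brH :: "'h \<Rightarrow> 'h \<Rightarrow> 'h"
    and \<rho> :: "'g \<Rightarrow> 'h \<Rightarrow> 'h"
    and \<mu> :: "'h \<Rightarrow> 'g \<Rightarrow> 'g" +
  assumes matched1: "\<And>x a b.
      \<rho> x (brH a b) - brH (\<rho> x a) b - brH a (\<rho> x b) + \<rho> (\<mu> a x) b - \<rho> (\<mu> b x) a = 0"
    and matched2: "\<And>a x y.
      \<mu> a (brG x y) - brG (\<mu> a x) y - brG x (\<mu> a y) + \<mu> (\<rho> x a) y - \<mu> (\<rho> y a) x = 0"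

end

theory Submission
  imports Defs
begin

text \<open>
  Antisymmetrising the bimodule and matched-pair identities yields their Lie counterparts: the mixed
  commutators in \<open>[l\<^sub>x - r\<^sub>x, l\<^sub>y - r\<^sub>y]\<close> cancel, and the first Lie
  compatibility condition is the first matched-pair identity at \<open>(a, b)\<close> minus the same identity at
  \<open>(b, a)\<close> minus the third one. The other Lie condition follows by exchanging the two algebras.
\<close>

lemma bilinear_map_diff_left:
  assumes "bilinear_map sU sV sW f"
  shows "f (u - u') v = f u v - f u' v"
proof -
  interpret Vector_Spaces.linear sU sW "\<lambda>u. f u v"
    using assms by (simp add: bilinear_map_def)
  show ?thesis by (rule diff)
qed

lemma bilinear_map_diff_right:
  assumes "bilinear_map sU sV sW f"
  shows "f u (v - v') = f u v - f u v'"
proof -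
  interpret Vector_Spaces.linear sV sW "f u"
    using assms by (simp add: bilinear_map_def)
  show ?thesis by (rule diff)
qed

lemma linear_sub:
  assumes "Vector_Spaces.linear s1 s2 f" and "Vector_Spaces.linear s1 s2 g"
  shows "Vector_Spaces.linear s1 s2 (\<lambda>x. f x - g x)"
proof -
  \<comment> \<open>Linearity of \<open>f\<close> includes that \<open>s1\<close> and
    \<open>s2\<close> are vector spaces, which \<open>vector_space_pair\<close> needs.\<close>
  interpret f: Vector_Spaces.linear s1 s2 f by fact
  interpret vector_space_pair s1 s2 by unfold_locales
  show ?thesis by (rule linear_compose_sub[OF assms])
qed

lemma bilinear_map_sub:
  assumes "bilinear_map sU sV sW f" and "bilinear_map sU sV sW g"
  shows "bilinear_map sU sV sW (\<lambda>u v. f u v - g u v)"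
  using assms unfolding bilinear_map_def by (auto intro!: linear_sub)

lemma bilinear_map_flip:
  "bilinear_map sU sV sW f \<Longrightarrow> bilinear_map sV sU sW (\<lambda>v u. f u v)"
  by (simp add: bilinear_map_def)

context center_symmetric_algebra
begin

lemma bilinear_sub_adjacent: "bilinear_map s s s (sub_adjacent m)"
  unfolding sub_adjacent_def by (rule bilinear_map_sub[OF bilinear bilinear_map_flip[OF bilinear]])

text \<open>For any bilinear product, the cyclic sum of double commutators is the alternating sum of
  the six associators of x, y, z. Center symmetry makes them cancel in pairs.\<close>

lemma sub_adjacent_jacobi:
  "sub_adjacent m x (sub_adjacent m y z) + sub_adjacent m y (sub_adjacent m z x)
     + sub_adjacent m z (sub_adjacent m x y) = 0" (is "?lhs = 0")
proof -
  have "?lhs = (associator m z y x - associator m x y z) + (associator m x z y - associator m y z x)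
    + (associator m y x z - associator m z x y)"
    unfolding sub_adjacent_def associator_def
      bilinear_map_diff_left[OF bilinear] bilinear_map_diff_right[OF bilinear]
    by (simp only: diff_conv_add_uminus minus_add_distrib minus_minus ac_simps)
  then show ?thesis
    by (simp only: center_symmetric[of z y x] center_symmetric[of x z y] center_symmetric[of y x z] diff_self add_0)
qed

sublocale sub_adjacent: lie_algebra s "sub_adjacent m"
proof
  show "sub_adjacent m x x = 0" for x by (simp add: sub_adjacent_def)
qed (fact finite_dim bilinear_sub_adjacent sub_adjacent_jacobi)+

end

context center_symmetric_bimodule
begin

lemma sub_adjacent_rep_bracket:
  "l (sub_adjacent m x y) v - r (sub_adjacent m x y) v
     = gl_bracket (\<lambda>v. l x v - r x v) (\<lambda>v. l y v - r y v) v"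
    (is "?lhs = ?rhs")
proof -
  \<comment> \<open>\<open>?D\<close> is the defect of \<open>l_r_mult\<close> and \<open>?E\<close>
    that of \<open>commutator_symmetric\<close>. Antisymmetrising \<open>?D\<close> gives all terms
    free of mixed products of l and r; \<open>?E\<close> gives the mixed ones.\<close>
  let ?D = "\<lambda>x y. (l (m x y) v - l x (l y v)) - (r x (r y v) - r (m y x) v)"
  let ?E = "gl_bracket (l x) (r y) v - gl_bracket (l y) (r x) v"
  have "?lhs - ?rhs = ?D x y - ?D y x + ?E"
    unfolding sub_adjacent_def gl_bracket_def
      bilinear_map_diff_left[OF l_linear] bilinear_map_diff_left[OF r_linear]
      bilinear_map_diff_right[OF l_linear] bilinear_map_diff_right[OF r_linear]
    by (simp only: diff_conv_add_uminus minus_add_distrib minus_minus ac_simps)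
  then have "?lhs - ?rhs = 0"
    by (simp only: l_r_mult commutator_symmetric[of x y] diff_self add_0)
  then show ?thesis by simp
qed

sublocale sub_adjacent: lie_representation s "sub_adjacent m" sV "\<lambda>x v. l x v - r x v"
proof
  show "linear_to_gl s sV (\<lambda>x v. l x v - r x v)"
    by (rule bilinear_map_sub[OF l_linear r_linear])
qed (rule ext, fact sub_adjacent_rep_bracket)

end

text \<open>The exchange interchanges \<open>matched1\<close> with \<open>matched2\<close> and
  \<open>matched3\<close> with \<open>matched4\<close>, so only one Lie condition has to be
  computed.\<close>

lemma (in center_symmetric_matched_pair) swap:
  "center_symmetric_matched_pair sB mB sA mA lB rB lA rA"
  by unfold_locales (fact matched1 matched2 matched3 matched4)+

lemma (in center_symmetric_matched_pair) sub_adjacent_matched: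
  "(lA x (sub_adjacent mB a b) - rA x (sub_adjacent mB a b))
     - sub_adjacent mB (lA x a - rA x a) b - sub_adjacent mB a (lA x b - rA x b)
     + (lA (lB a x - rB a x) b - rA (lB a x - rB a x) b)
     - (lA (lB b x - rB b x) a - rA (lB b x - rB b x) a) = 0" (is "?lhs = 0")
proof -
  let ?M1 = "\<lambda>a b. - rA x (a \<odot> b) + rA (lB b x) a + a \<odot> rA x b + lA (rB b x) a
      + lA x b \<odot> a - lA x (b \<odot> a)"
  \<comment> \<open>\<open>?M3\<close> changes sign under exchange of a and b, so it is subtracted
    once, whereas \<open>?M1\<close> has to be antisymmetrised.\<close>
  let ?M3 = "a \<odot> lA x b + rA x b \<odot> a - rA x a \<odot> b - lA (lB a x) b + rA (rB b x) a
      + lA (lB b x) a - b \<odot> lA x a - rA (rB a x) b"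
  have "?lhs = ?M1 a b - ?M1 b a - ?M3"
    unfolding sub_adjacent_def
      bilinear_map_diff_left[OF AB.l_linear] bilinear_map_diff_left[OF AB.r_linear]
      bilinear_map_diff_right[OF AB.l_linear] bilinear_map_diff_right[OF AB.r_linear]
      bilinear_map_diff_left[OF B.bilinear] bilinear_map_diff_right[OF B.bilinear]
    by (simp only: diff_conv_add_uminus minus_add_distrib minus_minus ac_simps)
  then show ?thesis by (simp only: matched1 matched3 diff_0_right)
qed

theorem corollary3p7:
  fixes sA :: "'k::field_char_0 \<Rightarrow> 'a::ab_group_add \<Rightarrow> 'a"
    and mA :: "'a \<Rightarrow> 'a \<Rightarrow> 'a"
    and sB :: "'k \<Rightarrow> 'b::ab_group_add \<Rightarrow> 'b"
    and mB :: "'b \<Rightarrow> 'b \<Rightarrow> 'b"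
    and lA rA :: "'a \<Rightarrow> 'b \<Rightarrow> 'b"
    and lB rB :: "'b \<Rightarrow> 'a \<Rightarrow> 'a"
  assumes "center_symmetric_matched_pair sA mA sB mB lA rA lB rB"
  shows "lie_matched_pair sA (sub_adjacent mA) sB (sub_adjacent mB)
           (\<lambda>x a. lA x a - rA x a) (\<lambda>a x. lB a x - rB a x)"
proof -
  interpret center_symmetric_matched_pair sA mA sB mB lA rA lB rB by fact
  interpret swapped: center_symmetric_matched_pair sB mB sA mA lB rB lA rA by (rule swap)
  show ?thesis
    \<comment> \<open>The sublocales supply both Lie algebras and both representations; only the two
      compatibility conditions remain, one from each interpretation.\<close>
    by unfold_locales (fact sub_adjacent_matched swapped.sub_adjacent_matched)+
qed

end
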